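(* Let $p$ be a prime, $s\ge 1$ an integer, $q=p^{2s}$ and $c\in\mathbb F_{q^2}\setminus\mathbb F_q$. Let $L=DS(\mathbb F_{q^2},c)$ be the quasigroup on $\mathbb F_{q^2}$ with multiplication $x*y=x+(y-x)c$. Then $L$ is a division sudoku of rank $q$ satisfying $\sigma(L)\ge q^2+q=p^{4s}+p^{2s}$. In particular, $\sigma(p^{2s})\ge p^{4s}+p^{2s}$.
   Context: $\mathbb F_q$ is the field of order $q$, regarded as a subfield of $\mathbb F_{q^2}$. A quasigroup on a finite set $X$ is identified with its multiplication table, a latin square $L$ on $X$ (array with $L(x,y)=x*y$ whose every row and column contains all symbols). For $c\in\mathbb F_{q^2}\setminus\{0,1\}$, $(\mathbb F_{q^2},* )$ is indeed a quasigroup. Let $|X|=m^2$. A sudoku partition of $X$ is a partition $\{X_1,\dots,X_m\}$ of $X$ into $m$ blocks of size $m$. With $O(L)=\{(x,y,L(x,y)):x,y\in X\}$, the bands, stacks and piles of $L$ are $B_i=\{(x,y,z)\in O(L):x\in X_i\}$, $S_i=\{(x,y,z)\in O(L):y\in X_i\}$, $P_i=\{(x,y,z)\in O(L):z\in X_i\}$. $L$ is a division sudoku of rank $m$ with respect to the sudoku partition if for all $i,j$: every $z\in X$ occurs as a third coordinate in $B_i\cap S_j$, every $y\in X$ occurs as a second coordinate in $B_i\cap P_j$, and every $x\in X$ occurs as a first coordinate in $S_i\cap P_j$. $\sigma(L)$ is the number of sudoku partitions of $X$ with respect to which $L$ is a division sudoku. For $m\ge 3$, $\sigma(m)=\max\{\sigma(L):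 L \text{ is a division sudoku of rank } m\}$, the maximum over latin squares of order $m^2$ that are division sudokus with respect to at least one sudoku partition. *)

theory Defs
  imports "HOL-Library.Disjoint_Sets" "HOL-Algebra.Subrings"
    "HOL-Computational_Algebra.Primes"
begin

definition latin_square :: "'a set \<Rightarrow> ('a \<Rightarrow> 'a \<Rightarrow> 'a) \<Rightarrow> bool" where
  "latin_square X L \<longleftrightarrow>
     finite X \<and> (\<forall>x\<in>X. L x ` X = X) \<and> (\<forall>y\<in>X. (\<lambda>x. L x y) ` X = X)"

definition ls_triples :: "'a set \<Rightarrow> ('a \<Rightarrow> 'a \<Rightarrow> 'a) \<Rightarrow> ('a \<times> 'a \<times> 'a) set" where
  "ls_triples X L = {(x, y, L x y) | x y. x \<in> X \<and> y \<in> X}"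

definition band :: "'a set \<Rightarrow> ('a \<Rightarrow> 'a \<Rightarrow> 'a) \<Rightarrow> 'a set \<Rightarrow> ('a \<times> 'a \<times> 'a) set" where
  "band X L A = {(x, y, z). (x, y, z) \<in> ls_triples X L \<and> x \<in> A}"

definition stack :: "'a set \<Rightarrow> ('a \<Rightarrow> 'a \<Rightarrow> 'a) \<Rightarrow> 'a set \<Rightarrow> ('a \<times> 'a \<times> 'a) set" where
  "stack X L A = {(x, y, z). (x, y, z) \<in> ls_triples X L \<and> y \<in> A}"

definition pile :: "'a set \<Rightarrow> ('a \<Rightarrow> 'a \<Rightarrow> 'a) \<Rightarrow> 'a set \<Rightarrow> ('a \<times> 'a \<times> 'a) set" where
  "pile X L A = {(x, y, z). (x, y, z) \<in> ls_triples X L \<and> z \<in> A}"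

definition sudoku_partition :: "nat \<Rightarrow> 'a set \<Rightarrow> 'a set set \<Rightarrow> bool" where
  "sudoku_partition m X P \<longleftrightarrow>
     finite X \<and> card X = m\<^sup>2 \<and> partition_on X P \<and> card P = m \<and> (\<forall>A\<in>P. card A = m)"

definition division_sudoku_wrt ::
  "nat \<Rightarrow> 'a set \<Rightarrow> 'a set set \<Rightarrow> ('a \<Rightarrow> 'a \<Rightarrow> 'a) \<Rightarrow> bool" where
  "division_sudoku_wrt m X P L \<longleftrightarrow>
     latin_square X L \<and> sudoku_partition m X P \<and>
     (\<forall>A\<in>P. \<forall>B\<in>P.
        (\<forall>z\<in>X. \<exists>x y. (x, y, z) \<in> band X L A \<inter> stack X L B) \<and>
        (\<forall>y\<in>X. \<exists>x z. (x, y, z) \<in> band X L A \<inter> pile X L B) \<and>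
        (\<forall>x\<in>X. \<exists>y z. (x, y, z) \<in> stack X L A \<inter> pile X L B))"

definition division_sudoku :: "nat \<Rightarrow> 'a set \<Rightarrow> ('a \<Rightarrow> 'a \<Rightarrow> 'a) \<Rightarrow> bool" where
  "division_sudoku m X L \<longleftrightarrow> (\<exists>P. division_sudoku_wrt m X P L)"

text \<open>The rank is determined by the cardinality of \<open>X\<close>, so the quantifier over \<open>m\<close>
  below is harmless.\<close>

definition sudoku_sigma :: "'a set \<Rightarrow> ('a \<Rightarrow> 'a \<Rightarrow> 'a) \<Rightarrow> nat" where
  "sudoku_sigma X L = card {P. \<exists>m. division_sudoku_wrt m X P L}"

text \<open>Since \<^const>\<open>sudoku_sigma\<close> is invariant under relabelling of the symbols, the maximum
  over all division sudokus of rank \<open>m\<close> may be taken over those on the symbol set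
  \<open>{..<m\<^sup>2}\<close>.  The set of values is finite; \<^const>\<open>Max\<close> is meaningful whenever
  some division sudoku of rank \<open>m\<close> exists.\<close>

definition sudoku_sigma_max :: "nat \<Rightarrow> nat" where
  "sudoku_sigma_max m =
     Max {sudoku_sigma {..<m\<^sup>2} L | L. division_sudoku m {..<m\<^sup>2} L}"

definition DS :: "('a, 'b) ring_scheme \<Rightarrow> 'a \<Rightarrow> 'a \<Rightarrow> 'a \<Rightarrow> 'a" where
  "DS F c x y = x \<oplus>\<^bsub>F\<^esub> (y \<ominus>\<^bsub>F\<^esub> x) \<otimes>\<^bsub>F\<^esub> c"

end

theory Submission
  imports Defs "HOL-Algebra.Algebraic_Closure" "HOL-Algebra.Multiplicative_Group"
    "HOL-Number_Theory.Residues"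
begin

text \<open>
  Write \<open>r = p\<^sup>s\<close>, so that \<open>q = r\<^sup>2\<close> and the field has order \<open>r\<^sup>4\<close>.  The product is
  \<open>x * y = (1 - c)x + cy\<close>.  For an additive subgroup \<open>H\<close> of order \<open>q\<close>, the cosets of \<open>H\<close> form a
  sudoku partition, and the division sudoku conditions say that any two of \<open>H\<close>, \<open>cH\<close> and
  \<open>(1 - c)H\<close> meet only in \<open>0\<close>.  They all reduce to one requirement: \<open>H\<close> contains no \<open>h \<noteq> 0\<close>
  together with \<open>ch\<close> (\<open>division_sudoku_cosets\<close>).

  Lines over \<open>F\<^sub>q\<close> give only \<open>q + 1\<close> such subgroups.  Many more come from the subfield \<open>k\<close> of order
  \<open>r\<close>, over which the field has dimension 4: take for \<open>H\<close> the planes, that is the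
  two-dimensional \<open>k\<close>-subspaces.  Counting ordered bases, there are \<open>(q + 1)(q + r + 1)\<close> planes
  (\<open>card_planes_ge\<close>).  A plane that contains some \<open>h \<noteq> 0\<close> and \<open>ch\<close> is spanned by these two
  elements, because \<open>c\<close> is not in \<open>k\<close>; since \<open>h\<close> matters only up to a factor in \<open>k\<close>, there are at
  most \<open>(q\<^sup>2 - 1)/(r - 1) = (q + 1)(r + 1)\<close> such planes (\<open>card_multiples_planes_le\<close>).  At least
  \<open>(q + 1)q = q\<^sup>2 + q\<close> planes remain, and different subgroups have different coset partitions.

  The field theory needed is that of the Frobenius map.  The subfield \<open>k\<close> consists of the
  solutions of \<open>x\<^sup>r = x\<close>; a norm argument shows that there are exactly \<open>r\<close> of them
  (\<open>card_frobenius_fixed\<close>), and \<open>k\<close> lies in the given subfield of order \<open>q\<close>, which is the set of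
  solutions of \<open>x\<^sup>q = x\<close>.  For the bound on the maximum over all division sudokus, a field of order
  \<open>q\<^sup>2\<close> has to exist; it is the set of roots of \<open>X\<^sup>N - X\<close> with \<open>N = q\<^sup>2\<close> in an algebraic closure of
  the prime field, and these roots are simple (\<open>exists_field_of_prime_power_order\<close>).
\<close>

section \<open>Coset partitions that are division sudokus\<close>

lemma (in abelian_group) a_rcoset_diff_mem:
  assumes "additive_subgroup H G" "A \<in> a_rcosets H" "x \<in> A" "y \<in> A"
  shows "x \<ominus> y \<in> H"
proof -
  interpret H: additive_subgroup H G by fact
  obtain a where a: "a \<in> carrier G" "A = H +> a"
    using assms(2) by (auto simp: A_RCOSETS_def')
  obtain h k where h: "h \<in> H" "x = h \<oplus> a" and k: "k \<in> H" "y = k \<oplus> a"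
    using assms(3,4) a by (auto simp: a_r_coset_def')
  have "x \<ominus> y = h \<ominus> k"
    using h(1) k(1) a(1) H.a_Hcarr r_neg2[of a "\<ominus> k"]
    unfolding h(2) k(2) a_comm[of k a, OF H.a_Hcarr[OF k(1)] a(1)]
    by (simp add: a_minus_def minus_add a_assoc)
  then show ?thesis using h k by (simp add: a_minus_def)
qed

lemma (in abelian_group) a_rcosets_partition:
  assumes H: "additive_subgroup H G" and fin: "finite (carrier G)"
  shows "partition_on (carrier G) (a_rcosets H)"
    and "\<And>A. A \<in> a_rcosets H \<Longrightarrow> card A = card H"
    and "card (a_rcosets H) * card H = card (carrier G)"
    and "H \<in> a_rcosets H"
proof -
  interpret H: additive_subgroup H G by fact
  interpret S: subgroup H "add_monoid G" by (rule H.a_subgroup)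
  have ar: "a_rcosets H = rcosets\<^bsub>add_monoid G\<^esub> H" by (simp add: A_RCOSETS_def)
  show "\<And>A. A \<in> a_rcosets H \<Longrightarrow> card A = card H"
    using group.card_rcosets_equal[OF a_group] S.subset ar by fastforce
  show "card (a_rcosets H) * card H = card (carrier G)"
    using group.lagrange[OF a_group H.a_subgroup] by (simp add: ar order_def)
  show "H \<in> a_rcosets H"
    using S.subgroup_in_rcosets[OF a_group] by (simp add: ar)
  show "partition_on (carrier G) (a_rcosets H)"
  proof (rule partition_onI)
    show "\<Union> (a_rcosets H) = carrier G"
      using group.rcosets_part_G[OF a_group H.a_subgroup] by (simp add: ar)
    show "\<And>p p'. p \<in> a_rcosets H \<Longrightarrow> p' \<in> a_rcosets H \<Longrightarrow> p \<noteq> p' \<Longrightarrow> disjnt p p'"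
      using group.rcos_disjoint[OF a_group H.a_subgroup] by (auto simp: ar pairwise_def)
    show "{} \<notin> a_rcosets H"
      using S.rcosets_non_empty ar by blast
  qed
qed

text \<open>
  If \<open>\<alpha>H\<close> and \<open>\<beta>H\<close> meet only in \<open>\<zero>\<close> and \<open>|H|\<^sup>2\<close> is the order of the field, then
  \<open>(x, y) \<mapsto> \<alpha>x + \<beta>y\<close> is injective on a product of two cosets of \<open>H\<close>, hence onto the field by
  counting.
\<close>

lemma (in field) coset_direct_sum:
  assumes fin: "finite (carrier R)" and H: "additive_subgroup H R"
    and card: "card H * card H = card (carrier R)"
    and ab: "\<alpha> \<in> carrier R" "\<beta> \<in> carrier R"
    and triv: "\<And>h k. h \<in> H \<Longrightarrow> k \<in> H \<Longrightarrow> \<alpha> \<otimes> h = \<beta> \<otimes> k \<Longrightarrow> h = \<zero> \<and> k = \<zero>"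
    and A: "A \<in> a_rcosets H" and B: "B \<in> a_rcosets H" and z: "z \<in> carrier R"
  shows "\<exists>x\<in>A. \<exists>y\<in>B. z = \<alpha> \<otimes> x \<oplus> \<beta> \<otimes> y"
proof -
  interpret H: additive_subgroup H R by fact
  have AB: "A \<subseteq> carrier R" "B \<subseteq> carrier R"
    using a_rcosets_partition(1)[OF H fin] A B by (auto simp: partition_on_def)
  define f where "f = (\<lambda>(x, y). \<alpha> \<otimes> x \<oplus> \<beta> \<otimes> y)"
  have "inj_on f (A \<times> B)"
  proof (rule inj_onI, clarify)
    fix x y x' y' assume m: "x \<in> A" "y \<in> B" "x' \<in> A" "y' \<in> B" and e: "f (x, y) = f (x', y')"
    have c: "x \<in> carrier R" "x' \<in> carrier R" "y \<in> carrier R" "y' \<in> carrier R"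
      using m AB by auto
    from e have e': "\<alpha> \<otimes> x \<oplus> \<beta> \<otimes> y = \<alpha> \<otimes> x' \<oplus> \<beta> \<otimes> y'" by (simp add: f_def)
    have "\<alpha> \<otimes> (x \<ominus> x') = (\<alpha> \<otimes> x \<oplus> \<beta> \<otimes> y) \<ominus> \<beta> \<otimes> y \<ominus> \<alpha> \<otimes> x'"
      using c ab by algebra
    also have "\<dots> = (\<alpha> \<otimes> x' \<oplus> \<beta> \<otimes> y') \<ominus> \<beta> \<otimes> y \<ominus> \<alpha> \<otimes> x'" by (simp only: e')
    also have "\<dots> = \<beta> \<otimes> (y' \<ominus> y)"
      using c ab by algebra
    finally have "x \<ominus> x' = \<zero> \<and> y' \<ominus> y = \<zero>"
      using triv a_rcoset_diff_mem[OF H A m(1,3)] a_rcoset_diff_mem[OF H B m(4,2)] by blast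
    then show "x = x' \<and> y = y'" using c by (metis r_right_minus_eq)
  qed
  then have "card (f ` (A \<times> B)) = card (carrier R)"
    using card a_rcosets_partition(2)[OF H fin] A B by (simp add: card_image card_cartesian_product)
  moreover have "f ` (A \<times> B) \<subseteq> carrier R"
    using AB ab by (auto simp: f_def)
  ultimately have "f ` (A \<times> B) = carrier R"
    using fin by (metis card_subset_eq)
  then have "z \<in> f ` (A \<times> B)" using z by simp
  then show ?thesis by (auto simp: f_def)
qed

lemma (in field) DS_latin_square:
  assumes fin: "finite (carrier R)" and c: "c \<in> carrier R" "c \<noteq> \<zero>" "c \<noteq> \<one>"
  shows "latin_square (carrier R) (DS R c)"
  unfolding latin_square_def
proof (intro conjI ballI)
  have surj: "f ` carrier R = carrier R"
    if "inj_on f (carrier R)" "f ` carrier R \<subseteq> carrier R" for f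
    by (rule endo_inj_surj[OF fin that(2,1)])
  have one: "\<one> \<ominus> c \<noteq> \<zero>" using c by simp
  show "DS R c x ` carrier R = carrier R" if x: "x \<in> carrier R" for x
  proof (rule surj)
    show "inj_on (DS R c x) (carrier R)"
    proof (rule inj_onI)
      fix y z assume yz: "y \<in> carrier R" "z \<in> carrier R" and "DS R c x y = DS R c x z"
      then have "(y \<ominus> x) \<otimes> c = (z \<ominus> x) \<otimes> c" using x c by (simp add: DS_def)
      then have "y \<ominus> x = z \<ominus> x" using x c yz by (metis m_rcancel minus_closed)
      then show "y = z" using x yz by (simp add: a_minus_def)
    qed
    show "DS R c x ` carrier R \<subseteq> carrier R" using x c by (auto simp: DS_def)
  qed
  show "(\<lambda>x. DS R c x y) ` carrier R = carrier R" if y: "y \<in> carrier R" for y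
  proof (rule surj)
    have D: "DS R c x y = (\<one> \<ominus> c) \<otimes> x \<oplus> c \<otimes> y" if "x \<in> carrier R" for x
      unfolding DS_def using that y c by algebra
    show "inj_on (\<lambda>x. DS R c x y) (carrier R)"
    proof (rule inj_onI)
      fix x z assume xz: "x \<in> carrier R" "z \<in> carrier R" and "DS R c x y = DS R c z y"
      then have "(\<one> \<ominus> c) \<otimes> x = (\<one> \<ominus> c) \<otimes> z" using y c by (simp add: D)
      then show "x = z" using one xz c by (metis m_lcancel minus_closed one_closed)
    qed
    show "(\<lambda>x. DS R c x y) ` carrier R \<subseteq> carrier R" using y c by (auto simp: DS_def)
  qed
qed (rule fin)

text \<open>
  The product is \<open>(1 - c)x + cy\<close>, so the three sudoku conditions ask that any two of the groups
  \<open>H\<close>, \<open>cH\<close>, \<open>(1 - c)H\<close> meet trivially.  All three follow from \<open>H \<inter> cH = 0\<close>: if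
  \<open>(1 - c)h = k\<close> with \<open>h, k\<close> in \<open>H\<close>, then \<open>ch = h - k\<close> is in \<open>H\<close>; and if \<open>(1 - c)h = ck\<close>, then
  \<open>h = c(h + k)\<close>, so that \<open>h + k\<close> and its multiple by \<open>c\<close> both lie in \<open>H\<close>.
\<close>

lemma (in field) division_sudoku_cosets:
  assumes fin: "finite (carrier R)" and H: "additive_subgroup H R"
    and card: "card (carrier R) = q\<^sup>2" "card H = q"
    and c: "c \<in> carrier R" "c \<noteq> \<zero>" "c \<noteq> \<one>"
    and free: "\<And>h. h \<in> H \<Longrightarrow> c \<otimes> h \<in> H \<Longrightarrow> h = \<zero>"
  shows "division_sudoku_wrt q (carrier R) (a_rcosets H) (DS R c)"
proof -
  interpret H: additive_subgroup H R by fact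
  let ?L = "DS R c"
  note facts = a_rcosets_partition[OF H fin]
  have AA: "A \<subseteq> carrier R" if "A \<in> a_rcosets H" for A
    using facts(1) that by (auto simp: partition_on_def)
  have D: "?L x y = (\<one> \<ominus> c) \<otimes> x \<oplus> c \<otimes> y" if "x \<in> carrier R" "y \<in> carrier R" for x y
    unfolding DS_def using that c by algebra
  have Dc: "?L x y \<in> carrier R" if "x \<in> carrier R" "y \<in> carrier R" for x y
    unfolding DS_def using that c by simp
  have q0: "q > 0"
  proof (rule ccontr)
    assume "\<not> q > 0"
    then have "carrier R = {}" using card(1) fin by simp
    then show False using one_closed by blast
  qed
  have latin: "latin_square (carrier R) ?L" by (rule DS_latin_square[OF fin c])
  have cardH: "card H * card H = card (carrier R)" using card by (simp add: power2_eq_square)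
  have "card (a_rcosets H) = q" using facts(3) card q0 by (simp add: power2_eq_square)
  then have part: "sudoku_partition q (carrier R) (a_rcosets H)"
    unfolding sudoku_partition_def using fin card facts(1,2) by simp
  have one: "\<one> \<ominus> c \<noteq> \<zero>" "\<one> \<ominus> c \<in> carrier R" using c by simp_all
  note hc = H.a_Hcarr
  have zz: "x \<otimes> h = \<zero> \<longleftrightarrow> h = \<zero>" if "x \<in> carrier R" "x \<noteq> \<zero>" "h \<in> H" for x h
    using that(1,2) hc[OF that(3)] by (simp add: integral_iff)
  have t1: "h = \<zero> \<and> k = \<zero>" if hk: "h \<in> H" "k \<in> H" "(\<one> \<ominus> c) \<otimes> h = c \<otimes> k" for h k
  proof -
    have "c \<otimes> (h \<oplus> k) = c \<otimes> h \<oplus> c \<otimes> k" using c(1) hc[OF hk(1)] hc[OF hk(2)] by algebra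
    also have "\<dots> = c \<otimes> h \<oplus> (\<one> \<ominus> c) \<otimes> h" using hk by simp
    also have "\<dots> = h" using c(1) hc[OF hk(1)] hc[OF hk(2)] by algebra
    finally have e: "c \<otimes> (h \<oplus> k) = h" .
    then have "h \<oplus> k = \<zero>" using free hk by simp
    then have "h = \<zero>" using e c by simp
    then show ?thesis using hk c zz by (metis hc r_null one(2))
  qed
  have t2: "h = \<zero> \<and> k = \<zero>" if hk: "h \<in> H" "k \<in> H" "(\<one> \<ominus> c) \<otimes> h = (\<ominus> \<one>) \<otimes> k" for h k
  proof -
    have "c \<otimes> h = h \<ominus> (\<one> \<ominus> c) \<otimes> h" using c(1) hc[OF hk(1)] hc[OF hk(2)] by algebra
    also have "\<dots> = h \<ominus> (\<ominus> \<one>) \<otimes> k" using hk by simp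
    also have "\<dots> = h \<oplus> k" using hc[OF hk(1)] hc[OF hk(2)] by algebra
    finally have "h = \<zero>" using free hk by simp
    moreover have "k = \<ominus> ((\<ominus> \<one>) \<otimes> k)" using hc[OF hk(1)] hc[OF hk(2)] by algebra
    ultimately show ?thesis using hk one by (metis r_null minus_zero)
  qed
  have t3: "h = \<zero> \<and> k = \<zero>" if hk: "h \<in> H" "k \<in> H" "c \<otimes> h = (\<ominus> \<one>) \<otimes> k" for h k
  proof -
    have e: "c \<otimes> h = \<ominus> k" using hk hc by (simp add: l_minus)
    then have h: "h = \<zero>" using free hk by simp
    then have "\<ominus> k = \<zero>" using e c by simp
    then show ?thesis using h hk hc by (metis minus_minus minus_zero)
  qed
  show ?thesis
    unfolding division_sudoku_wrt_def
  proof (intro conjI ballI latin part)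
    fix A B assume AB: "A \<in> a_rcosets H" "B \<in> a_rcosets H"
    show "\<exists>x y. (x, y, z) \<in> band (carrier R) ?L A \<inter> stack (carrier R) ?L B"
      if z: "z \<in> carrier R" for z
    proof -
      obtain x y where xy: "x \<in> A" "y \<in> B" "z = (\<one> \<ominus> c) \<otimes> x \<oplus> c \<otimes> y"
        using coset_direct_sum[OF fin H cardH one(2) c(1) t1 AB z] by blast
      moreover have "x \<in> carrier R" "y \<in> carrier R" using xy AA AB by auto
      ultimately show ?thesis
        by (intro exI[of _ x] exI[of _ y]) (auto simp: band_def stack_def ls_triples_def D)
    qed
    show "\<exists>x z. (x, y, z) \<in> band (carrier R) ?L A \<inter> pile (carrier R) ?L B"
      if y: "y \<in> carrier R" for y
    proof -
      have "\<ominus> (c \<otimes> y) \<in> carrier R" using c y by simp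
      then obtain x z where xz: "x \<in> A" "z \<in> B" "\<ominus> (c \<otimes> y) = (\<one> \<ominus> c) \<otimes> x \<oplus> (\<ominus> \<one>) \<otimes> z"
        using coset_direct_sum[OF fin H cardH one(2) _ t2 AB] by blast
      have cr: "x \<in> carrier R" "z \<in> carrier R" using xz AA AB by auto
      have "?L x y = (\<one> \<ominus> c) \<otimes> x \<ominus> (\<ominus> (c \<otimes> y))" using D cr y c by (simp add: a_minus_def)
      also have "\<dots> = z" unfolding xz(3) using cr y c by algebra
      finally show ?thesis using xz cr y
        by (intro exI[of _ x] exI[of _ z]) (auto simp: band_def pile_def ls_triples_def)
    qed
    show "\<exists>y z. (x, y, z) \<in> stack (carrier R) ?L A \<inter> pile (carrier R) ?L B"
      if x: "x \<in> carrier R" for x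
    proof -
      have "\<ominus> ((\<one> \<ominus> c) \<otimes> x) \<in> carrier R" using c x by simp
      then obtain y z where yz: "y \<in> A" "z \<in> B" "\<ominus> ((\<one> \<ominus> c) \<otimes> x) = c \<otimes> y \<oplus> (\<ominus> \<one>) \<otimes> z"
        using coset_direct_sum[OF fin H cardH c(1) _ t3 AB] by blast
      have cr: "y \<in> carrier R" "z \<in> carrier R" using yz AA AB by auto
      have "?L x y = c \<otimes> y \<ominus> (\<ominus> ((\<one> \<ominus> c) \<otimes> x))" using D cr x c by algebra
      also have "\<dots> = z" unfolding yz(3) using cr c by algebra
      finally show ?thesis using yz cr x
        by (intro exI[of _ y] exI[of _ z]) (auto simp: stack_def pile_def ls_triples_def)
    qed
  qed
qed

section \<open>Counting with fibres\<close>

lemma card_le_mult_card_image_fibres: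
  assumes "finite A" "\<And>y. y \<in> f ` A \<Longrightarrow> card {x \<in> A. f x = y} \<le> n"
  shows "card A \<le> n * card (f ` A)"
proof -
  have "card A = (\<Sum>y\<in>f ` A. card {x \<in> A. f x = y})"
    using sum.image_gen[OF assms(1), of "\<lambda>_. 1::nat" f] by simp
  also have "\<dots> \<le> (\<Sum>y\<in>f ` A. n)" by (intro sum_mono assms)
  finally show ?thesis by (simp add: mult.commute)
qed

lemma mult_card_image_fibres_le_card:
  assumes "finite A" "\<And>y. y \<in> f ` A \<Longrightarrow> n \<le> card {x \<in> A. f x = y}"
  shows "n * card (f ` A) \<le> card A"
proof -
  have "n * card (f ` A) = (\<Sum>y\<in>f ` A. n)" by simp
  also have "\<dots> \<le> (\<Sum>y\<in>f ` A. card {x \<in> A. f x = y})" by (intro sum_mono assms)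
  also have "\<dots> = card A"
    using sum.image_gen[OF assms(1), of "\<lambda>_. 1::nat" f] by simp
  finally show ?thesis .
qed

section \<open>The Frobenius map\<close>

lemma (in cring) binomial_theorem:
  fixes n :: nat
  assumes x: "x \<in> carrier R" and y: "y \<in> carrier R"
  shows "(x \<oplus> y) [^] n = (\<Oplus>k\<in>{..n}. [(n choose k)] \<cdot> (x [^] k \<otimes> y [^] (n - k)))"
proof (induction n)
  case 0
  show ?case using x y by simp
next
  case (Suc n)
  define f where "f = (\<lambda>m k. [(n choose k)] \<cdot> (x [^] k \<otimes> y [^] (m - k)))"
  \<comment> \<open>The Pascal recurrence for \<open>n + 1\<close> over \<open>k + 1\<close> adds the coefficients of \<open>f n k \<otimes> x\<close> and \<open>g k\<close>.\<close>
  define g where "g = (\<lambda>k. [(n choose Suc k)] \<cdot> (x [^] Suc k \<otimes> y [^] (n - k)))"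
  have fc: "f m k \<in> carrier R" and gc: "g k \<in> carrier R" for m k
    using x y by (auto simp: f_def g_def)
  have tail: "(\<Oplus>k\<in>{..n}. g k) \<oplus> y [^] Suc n = (\<Oplus>k\<in>{..n}. f (Suc n) k)"
  proof -
    have "(\<Oplus>k\<in>{..Suc n}. f (Suc n) k) = (\<Oplus>k\<in>{..n}. f (Suc n) (Suc k)) \<oplus> f (Suc n) 0"
      using fc by (intro finsum_Suc2) auto
    moreover have "(\<Oplus>k\<in>{..n}. f (Suc n) (Suc k)) = (\<Oplus>k\<in>{..n}. g k)"
      by (simp add: f_def g_def)
    moreover have "f (Suc n) 0 = y [^] Suc n"
      using x y by (simp add: f_def)
    moreover have "(\<Oplus>k\<in>{..Suc n}. f (Suc n) k) = f (Suc n) (Suc n) \<oplus> (\<Oplus>k\<in>{..n}. f (Suc n) k)"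
      using fc by (intro finsum_Suc) auto
    moreover have "f (Suc n) (Suc n) = \<zero>"
      by (simp add: f_def binomial_eq_0)
    ultimately show ?thesis using fc by (simp add: finsum_closed Pi_def)
  qed
  have fx: "f n k \<otimes> x = [(n choose k)] \<cdot> (x [^] Suc k \<otimes> y [^] (n - k))" for k
    unfolding f_def using x y by (simp add: add_pow_ldistr add_pow_rdistr m_ac)
  have fy: "f n k \<otimes> y = f (Suc n) k" if "k \<le> n" for k
    unfolding f_def using x y that by (simp add: add_pow_ldistr add_pow_rdistr m_ac Suc_diff_le)
  have "(x \<oplus> y) [^] Suc n = (\<Oplus>k\<in>{..n}. f n k) \<otimes> (x \<oplus> y)"
    using Suc.IH by (simp add: f_def)
  also have "\<dots> = (\<Oplus>k\<in>{..n}. f n k) \<otimes> x \<oplus> (\<Oplus>k\<in>{..n}. f n k) \<otimes> y"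
    using x y fc by (simp add: r_distr finsum_closed Pi_def)
  also have "(\<Oplus>k\<in>{..n}. f n k) \<otimes> x = (\<Oplus>k\<in>{..n}. f n k \<otimes> x)"
    using x fc by (intro finsum_ldistr) auto
  also have "(\<Oplus>k\<in>{..n}. f n k) \<otimes> y = (\<Oplus>k\<in>{..n}. f n k \<otimes> y)"
    using y fc by (intro finsum_ldistr) auto
  also have "(\<Oplus>k\<in>{..n}. f n k \<otimes> y) = (\<Oplus>k\<in>{..n}. f (Suc n) k)"
    using fc fy by (intro finsum_cong') auto
  also have "\<dots> = (\<Oplus>k\<in>{..n}. g k) \<oplus> y [^] Suc n" by (rule tail [symmetric])
  also have "(\<Oplus>k\<in>{..n}. f n k \<otimes> x) \<oplus> ((\<Oplus>k\<in>{..n}. g k) \<oplus> y [^] Suc n) =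
      (\<Oplus>k\<in>{..n}. f n k \<otimes> x \<oplus> g k) \<oplus> y [^] Suc n"
    using x y fc gc by (simp add: finsum_addf a_assoc finsum_closed Pi_def)
  also have "(\<Oplus>k\<in>{..n}. f n k \<otimes> x \<oplus> g k) =
      (\<Oplus>k\<in>{..n}. [(Suc n choose Suc k)] \<cdot> (x [^] Suc k \<otimes> y [^] (Suc n - Suc k)))"
    using x y unfolding fx g_def
    by (intro finsum_cong') (auto simp: add.nat_pow_mult)
  also have "\<dots> \<oplus> y [^] Suc n =
      (\<Oplus>k\<in>{..Suc n}. [(Suc n choose k)] \<cdot> (x [^] k \<otimes> y [^] (Suc n - k)))"
    using x y by (subst finsum_Suc2) auto
  finally show ?case .
qed

lemma (in cring) add_pow_char_zero:
  assumes "[p] \<cdot> \<one> = \<zero>" "a \<in> carrier R" "p dvd (k::nat)"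
  shows "[k] \<cdot> a = \<zero>"
proof -
  obtain j where k: "k = p * j" using assms(3) by blast
  have "[p] \<cdot> a = ([p] \<cdot> \<one>) \<otimes> a" using assms(2) by (simp add: add_pow_ldistr)
  then have "[p] \<cdot> a = \<zero>" using assms by simp
  moreover have "[k] \<cdot> a = [j] \<cdot> ([p] \<cdot> a)"
    unfolding k using assms(2) by (simp add: add.nat_pow_pow)
  ultimately show ?thesis by simp
qed

lemma (in cring) freshmans_dream:
  assumes p: "Factorial_Ring.prime (p::nat)" and char: "[p] \<cdot> \<one> = \<zero>"
    and x: "x \<in> carrier R" and y: "y \<in> carrier R"
  shows "(x \<oplus> y) [^] p = x [^] p \<oplus> y [^] p"
proof -
  obtain m where m: "p = Suc (Suc m)"
    using prime_ge_2_nat[OF p] by (metis Suc_leD Suc_le_D numeral_2_eq_2 Suc_le_mono)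
  define f where "f = (\<lambda>k. [(p choose k)] \<cdot> (x [^] k \<otimes> y [^] (p - k)))"
  have fc: "f k \<in> carrier R" for k using x y by (simp add: f_def)
  have mid: "f (Suc k) = \<zero>" if "k \<le> m" for k
    unfolding f_def using x y that p m
    by (intro add_pow_char_zero[OF char] dvd_choose_prime) auto
  have "(x \<oplus> y) [^] p = (\<Oplus>k\<in>{..Suc (Suc m)}. f k)"
    unfolding f_def binomial_theorem[OF x y] by (simp add: m)
  also have "\<dots> = f p \<oplus> ((\<Oplus>k\<in>{..m}. f (Suc k)) \<oplus> f 0)"
    using fc finsum_Suc[of f "Suc m"] finsum_Suc2[of f m] by (simp add: m)
  also have "(\<Oplus>k\<in>{..m}. f (Suc k)) = (\<Oplus>k\<in>{..m}. \<zero>)"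
    using mid by (intro finsum_cong') auto
  also have "\<dots> = \<zero>" by simp
  also have "f p = x [^] p" using x y by (simp add: f_def)
  also have "f 0 = y [^] p" using x y by (simp add: f_def)
  finally show ?thesis using x y by simp
qed

lemma (in cring) freshmans_dream_power:
  assumes p: "Factorial_Ring.prime (p::nat)" and char: "[p] \<cdot> \<one> = \<zero>"
    and x: "x \<in> carrier R" and y: "y \<in> carrier R"
  shows "(x \<oplus> y) [^] (p ^ n) = x [^] (p ^ n) \<oplus> y [^] (p ^ n)"
proof (induction n)
  case 0
  show ?case using x y by simp
next
  case (Suc n)
  have "z [^] (p ^ Suc n) = (z [^] (p ^ n)) [^] p" if "z \<in> carrier R" for z
    using that by (simp add: nat_pow_pow mult.commute)
  then show ?case using x y Suc freshmans_dream[OF p char] by simp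
qed

section \<open>Fixed fields of powers of the Frobenius map\<close>

lemma (in comm_monoid) Units_nat_pow_inv:
  fixes n :: nat
  assumes u: "u \<in> Units G"
  shows "inv u [^] n \<otimes> u [^] n = \<one>" and "inv (u [^] n) = inv u [^] n"
proof -
  have "(inv u \<otimes> u) [^] n = \<one>" using u by (simp add: Units_l_inv)
  then show *: "inv u [^] n \<otimes> u [^] n = \<one>"
    using u by (simp add: nat_pow_distrib[symmetric] Units_closed)
  show "inv (u [^] n) = inv u [^] n"
    by (rule inv_char) (use u * in \<open>auto simp: Units_closed m_comm\<close>)
qed

lemma (in field) frobenius_fixed_subfield:
  assumes p: "Factorial_Ring.prime (p::nat)" and char: "[p] \<cdot> \<one> = \<zero>"
  shows "subfield {x \<in> carrier R. x [^] (p ^ n) = x} R"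
proof (rule subfieldI', rule subringI)
  let ?N = "p ^ n"
  have N: "?N > 0" using p by (simp add: prime_gt_0_nat)
  show "\<ominus> h \<in> {x \<in> carrier R. x [^] ?N = x}" if h: "h \<in> {x \<in> carrier R. x [^] ?N = x}" for h
  proof -
    \<comment> \<open>Additivity determines the power of \<open>\<ominus> h\<close> without a distinction by the parity of \<open>?N\<close>.\<close>
    have "\<zero> = (h \<oplus> \<ominus> h) [^] ?N" using h N by (simp add: r_neg nat_pow_zero)
    also have "\<dots> = h \<oplus> (\<ominus> h) [^] ?N"
      using freshmans_dream_power[OF p char, of h "\<ominus> h" n] h by simp
    finally show ?thesis using h sum_zero_eq_neg[of "(\<ominus> h) [^] ?N" h] by (simp add: a_comm)
  qed
  show "h \<oplus> k \<in> {x \<in> carrier R. x [^] ?N = x}"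
    if "h \<in> {x \<in> carrier R. x [^] ?N = x}" "k \<in> {x \<in> carrier R. x [^] ?N = x}" for h k
    using that freshmans_dream_power[OF p char, of h k n] by simp
  show "inv k \<in> {x \<in> carrier R. x [^] ?N = x}"
    if "k \<in> {x \<in> carrier R. x [^] ?N = x} - {\<zero>}" for k
    using that Units_nat_pow_inv(2)[of k ?N] by (auto simp: field_Units)
qed (auto simp: nat_pow_distrib)

text \<open>
  The order of the additive group annihilates \<open>\<one>\<close>, and a field has no zero divisors, so one of
  the factors \<open>p\<close> of that order already annihilates \<open>\<one>\<close>.
\<close>

lemma (in field) characteristic_of_prime_power_order:
  assumes fin: "finite (carrier R)" and card: "card (carrier R) = (p::nat) ^ m"
  shows "[p] \<cdot> \<one> = \<zero>"
proof -
  have step: "[(p ^ m)] \<cdot> \<one> = \<zero> \<Longrightarrow> [p] \<cdot> \<one> = \<zero>" for m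
  proof (induction m)
    case 0
    then show ?case by simp
  next
    case (Suc m)
    have "([p] \<cdot> \<one>) \<otimes> ([(p ^ m)] \<cdot> \<one>) = [p] \<cdot> ([(p ^ m)] \<cdot> \<one>)"
      by (simp add: add_pow_ldistr)
    also have "\<dots> = [(p ^ Suc m)] \<cdot> \<one>"
      by (simp add: add.nat_pow_pow mult.commute)
    finally have "([p] \<cdot> \<one>) \<otimes> ([(p ^ m)] \<cdot> \<one>) = \<zero>" using Suc.prems by simp
    then have "[p] \<cdot> \<one> = \<zero> \<or> [(p ^ m)] \<cdot> \<one> = \<zero>" by (simp add: integral_iff)
    then show ?case using Suc.IH by blast
  qed
  have "[card (carrier R)] \<cdot> \<one> = \<zero>"
    using group.pow_order_eq_1[OF a_group, of \<one>] fin by (simp add: order_def add_pow_def)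
  then show ?thesis using step card by metis
qed

lemma (in field) nonzero_pow_card:
  assumes "finite (carrier R)" "x \<in> carrier R" "x \<noteq> \<zero>"
  shows "x [^] (card (carrier R) - 1) = \<one>"
  using group.pow_order_eq_1[OF field_mult_group, of x] assms
  by (simp add: order_mult_of Multiplicative_Group.nat_pow_mult_of order_def[symmetric])

lemma (in field) pow_fixed_iff:
  assumes "x \<in> carrier R" "N > 0"
  shows "x [^] N = x \<longleftrightarrow> x = \<zero> \<or> x [^] (N - 1 :: nat) = \<one>"
proof -
  obtain M where M: "N = Suc M" using assms(2) by (cases N) auto
  show ?thesis
  proof (cases "x = \<zero>")
    case True
    then show ?thesis using M by simp
  next
    case False
    have "x [^] M \<otimes> x = \<one> \<otimes> x \<longleftrightarrow> x [^] M = \<one>"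
      using assms False by (intro m_rcancel) auto
    then show ?thesis using M False assms by simp
  qed
qed

text \<open>
  The nonzero solutions of \<open>x\<^sup>r = x\<close> are the roots of \<open>x\<^sup>r\<^sup>-\<^sup>1 = 1\<close>, at most \<open>r - 1\<close> in number.
  There are at least as many because of the norm \<open>x \<mapsto> x\<^sup>e\<close>, where
  \<open>e = 1 + r + \<dots> + r\<^sup>d\<^sup>-\<^sup>1\<close>: it maps the \<open>e(r - 1)\<close> nonzero elements of the field to such roots,
  and its fibres, being cosets of the group of \<open>e\<close>-th roots of unity, have at most \<open>e\<close> elements.
\<close>

lemma (in field) card_frobenius_fixed:
  fixes r d :: nat
  assumes fin: "finite (carrier R)" and card: "card (carrier R) = r ^ d" and r: "r \<ge> 2" and d: "d > 0"
  shows "card {x \<in> carrier R. x [^] r = x} = r"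
proof -
  let ?U = "carrier R - {\<zero>}" and ?V = "{x \<in> carrier R. x [^] (r - 1) = \<one>}"
  have r1: "r - 1 > 0" using r by simp
  define e where "e = (\<Sum>i<d. r ^ i)"
  have "r ^ n = (r - 1) * (\<Sum>i<n. r ^ i) + 1" for n
  proof -
    obtain r' where "r = Suc r'" using r by (cases r) auto
    then show ?thesis by (induction n) (auto simp: algebra_simps)
  qed
  then have "r ^ d - 1 = (r - 1) * e" unfolding e_def by (metis add_diff_cancel_right')
  then have e: "card (carrier R) - 1 = e * (r - 1)" using card by simp
  have e0: "e > 0" unfolding e_def using d r by (intro sum_pos) auto
  have nz: "x \<noteq> \<zero>" if "x \<in> ?V" for x
    using that r1 by (auto simp: nat_pow_zero)
  have fib: "card {x \<in> ?U. x [^] e = y} \<le> e" if y: "y \<in> (\<lambda>x. x [^] e) ` ?U" for y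
  proof -
    obtain x0 where x0: "x0 \<in> ?U" "y = x0 [^] e" using y by blast
    have u: "x0 \<in> Units R" using x0 by (simp add: field_Units)
    have i: "inv x0 \<in> carrier R" "inv x0 \<noteq> \<zero>" using u Units_inv_Units[OF u] by (auto simp: field_Units)
    have "card {x \<in> ?U. x [^] e = y} \<le> card {x \<in> carrier R. x [^] e = \<one>}"
    proof (rule card_inj_on_le)
      show "inj_on (\<lambda>x. inv x0 \<otimes> x) {x \<in> ?U. x [^] e = y}"
      proof (rule inj_onI)
        fix a b assume ab: "a \<in> {x \<in> ?U. x [^] e = y}" "b \<in> {x \<in> ?U. x [^] e = y}"
          and "inv x0 \<otimes> a = inv x0 \<otimes> b"
        then show "a = b" using m_lcancel[OF i(2,1), of a b] by simp
      qed
      show "(\<lambda>x. inv x0 \<otimes> x) ` {x \<in> ?U. x [^] e = y} \<subseteq> {x \<in> carrier R. x [^] e = \<one>}"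
      proof (rule image_subsetI)
        fix x assume "x \<in> {x \<in> ?U. x [^] e = y}"
        then have x: "x \<in> carrier R" "x [^] e = y" by auto
        have "(inv x0 \<otimes> x) [^] e = inv x0 [^] e \<otimes> x [^] e"
          using i(1) x(1) by (rule nat_pow_distrib)
        also have "\<dots> = \<one>" using Units_nat_pow_inv(1)[OF u, of e] x(2) x0(2) by simp
        finally show "inv x0 \<otimes> x \<in> {x \<in> carrier R. x [^] e = \<one>}"
          using i(1) x(1) by simp
      qed
    qed (use fin in simp)
    also have "\<dots> \<le> e" using num_roots_le_deg[OF fin, of e] e0 by simp
    finally show ?thesis .
  qed
  have "e * (r - 1) = card ?U" using e fin by simp
  also have "card ?U \<le> e * card ((\<lambda>x. x [^] e) ` ?U)"
    using fin fib by (intro card_le_mult_card_image_fibres) auto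
  also have "card ((\<lambda>x. x [^] e) ` ?U) \<le> card ?V"
  proof (rule card_mono)
    show "(\<lambda>x. x [^] e) ` ?U \<subseteq> ?V"
    proof (rule image_subsetI)
      fix x assume x: "x \<in> ?U"
      have "(x [^] e) [^] (r - 1) = x [^] (card (carrier R) - 1)"
        unfolding e using x by (simp add: nat_pow_pow)
      also have "\<dots> = \<one>" using x by (intro nonzero_pow_card[OF fin]) auto
      finally show "x [^] e \<in> ?V" using x by simp
    qed
  qed (use fin in simp)
  finally have "e * (r - 1) \<le> e * card ?V" by simp
  then have ge: "r - 1 \<le> card ?V" using e0 by simp
  have "card ?V \<le> r - 1" using num_roots_le_deg[OF fin, of "r - 1"] r1 by simp
  with ge have V: "card ?V = r - 1" by simp
  have "{x \<in> carrier R. x [^] r = x} = insert \<zero> ?V"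
    using pow_fixed_iff[of _ r] r by auto
  moreover have "\<zero> \<notin> ?V" using nz by blast
  ultimately show ?thesis using V r fin by simp
qed

text \<open>
  A subfield is determined by its order.  This is what makes two subfields comparable when only
  their orders are known.
\<close>

lemma (in field) subfield_eq_frobenius_fixed:
  fixes d :: nat
  assumes fin: "finite (carrier R)" and K: "subfield K R" and card: "card (carrier R) = card K ^ d" and d: "d > 0"
  shows "K = {x \<in> carrier R. x [^] card K = x}"
proof -
  let ?S = "R\<lparr>carrier := K\<rparr>"
  have KR: "K \<subseteq> carrier R" using subfieldE(3)[OF K] .
  then have finK: "finite K" using fin finite_subset by blast
  interpret S: field ?S using subfield_iff(2)[OF K] .
  have oz: "\<one> \<in> K" "\<zero> \<in> K" "\<one> \<noteq> \<zero>"
    using subringE(2,3)[OF subfieldE(1)[OF K]] by auto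
  then have K2: "card K \<ge> 2" using card_mono[OF finK, of "{\<zero>, \<one>}"] by simp
  have "x [^] card K = x" if x: "x \<in> K" for x
  proof -
    have "x = \<zero> \<or> x [^] (card K - 1) = \<one>"
      using S.nonzero_pow_card[of x] x finK by (auto simp: nat_pow_consistent[symmetric])
    then show ?thesis using pow_fixed_iff[of x "card K"] x KR K2 by auto
  qed
  then have "K \<subseteq> {x \<in> carrier R. x [^] card K = x}" using KR by blast
  then show ?thesis
    using card_frobenius_fixed[OF fin card K2 d] fin by (intro card_subset_eq) auto
qed

section \<open>Existence of finite fields\<close>

lemma (in ring_hom_ring) hom_add_pow:
  assumes "x \<in> carrier R"
  shows "h ([(n::nat)] \<cdot>\<^bsub>R\<^esub> x) = [n] \<cdot>\<^bsub>S\<^esub> (h x)"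
  using assms by (induction n) simp_all

lemma (in field) poly_of_const_ring_hom: "ring_hom_ring R (poly_ring R) poly_of_const"
  using canonical_embedding_ring_hom[OF carrier_is_subring] by simp

text \<open>
  Writing \<open>X\<close> as \<open>(X - a) + a\<close> lets the Frobenius map of the polynomial ring act on the two
  summands separately.
\<close>

lemma (in field) monic_linear_eq:
  assumes a: "a \<in> carrier R"
  shows "[\<one>, \<ominus> a] \<in> carrier (poly_ring R)"
    and "X = [\<one>, \<ominus> a] \<oplus>\<^bsub>poly_ring R\<^esub> poly_of_const a"
proof -
  show "[\<one>, \<ominus> a] \<in> carrier (poly_ring R)"
    using a by (simp add: univ_poly_def polynomial_def)
  show "X = [\<one>, \<ominus> a] \<oplus>\<^bsub>poly_ring R\<^esub> poly_of_const a"
    using a by (auto simp: univ_poly_add var_def poly_of_const_def l_neg)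
qed

lemma (in field) frobenius_poly:
  fixes N :: nat
  assumes N: "N > 1"
  defines "P \<equiv> X [^]\<^bsub>poly_ring R\<^esub> N \<ominus>\<^bsub>poly_ring R\<^esub> X"
  shows "P \<in> carrier (poly_ring R)" and "degree P = N" and "P \<noteq> []"
    and "\<And>a. a \<in> carrier R \<Longrightarrow> eval P a = a [^] N \<ominus> a"
proof -
  interpret UP: domain "poly_ring R" by (rule univ_poly_is_domain[OF carrier_is_subring])
  have X: "X \<in> carrier (poly_ring R)" by (rule var_closed(1)[OF carrier_is_subring])
  have XN: "X [^]\<^bsub>poly_ring R\<^esub> N \<in> carrier (poly_ring R)" using X by simp
  show P: "P \<in> carrier (poly_ring R)" unfolding P_def using X by simp
  have "degree (X [^]\<^bsub>poly_ring R\<^esub> N) = N"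
    using polynomial_pow_degree[OF X, of N] by (simp add: var_def)
  moreover have "degree (\<ominus>\<^bsub>poly_ring R\<^esub> X) = 1"
    using univ_poly_a_inv_degree[OF carrier_is_subring X] by (simp add: var_def)
  ultimately show "degree P = N"
    using poly_add_degree_eq[OF carrier_is_subring, of "X [^]\<^bsub>poly_ring R\<^esub> N" "\<ominus>\<^bsub>poly_ring R\<^esub> X"]
      XN UP.a_inv_closed[OF X] N
    unfolding P_def a_minus_def univ_poly_carrier by (simp add: univ_poly_add)
  then show "P \<noteq> []" using N by auto
  fix a assume a: "a \<in> carrier R"
  interpret ev: ring_hom_ring "poly_ring R" R "\<lambda>p. eval p a"
    by (rule eval_ring_hom[OF carrier_is_subring a])
  show "eval P a = a [^] N \<ominus> a"
    unfolding P_def using X XN a eval_var[OF a] ev.hom_nat_pow[OF X, of N]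
    by (simp add: a_minus_def)
qed

text \<open>
  Instead of the derivative, the argument uses the Frobenius map of the polynomial ring.  With
  \<open>N = p\<^sup>n\<close>, \<open>u = X - a\<close> and \<open>a\<^sup>N = a\<close>, it gives \<open>X\<^sup>N - X = u\<^sup>N - u\<close>.  If \<open>u\<^sup>2\<close> divided this
  polynomial, it would divide \<open>u\<close>, since it divides \<open>u\<^sup>N\<close>; the degrees forbid that.
\<close>

lemma (in field) frobenius_poly_simple_roots:
  fixes p n :: nat
  assumes p: "Factorial_Ring.prime p" and char: "[p] \<cdot> \<one> = \<zero>" and n: "n > 0"
    and a: "a \<in> carrier R" and root: "a [^] (p ^ n) = a"
  shows "alg_mult (X [^]\<^bsub>poly_ring R\<^esub> (p ^ n) \<ominus>\<^bsub>poly_ring R\<^esub> X) a \<le> 1"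
proof (rule ccontr)
  let ?UP = "poly_ring R"
  let ?N = "p ^ n"
  let ?P = "X [^]\<^bsub>?UP\<^esub> ?N \<ominus>\<^bsub>?UP\<^esub> X"
  let ?u = "[\<one>, \<ominus> a]"
  let ?a = "poly_of_const a"
  interpret UP: domain ?UP by (rule univ_poly_is_domain[OF carrier_is_subring])
  interpret c: ring_hom_ring R ?UP poly_of_const by (rule poly_of_const_ring_hom)
  have N: "?N \<ge> 2"
    using n prime_ge_2_nat[OF p] self_le_power[of p n] by linarith
  have N1: "?N > 1" using N by simp
  obtain M where M: "?N = 2 + M" using N le_Suc_ex by blast
  assume "\<not> alg_mult ?P a \<le> 1"
  then have "2 \<le> alg_mult ?P a" by simp
  then have "?u [^]\<^bsub>?UP\<^esub> (2::nat) divides\<^bsub>?UP\<^esub> ?P"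
    using le_alg_mult_imp_pdivides[OF a frobenius_poly(1)[OF N1], of 2]
    by (simp add: pdivides_def)
  then obtain w where w: "w \<in> carrier ?UP" "?P = ?u [^]\<^bsub>?UP\<^esub> (2::nat) \<otimes>\<^bsub>?UP\<^esub> w"
    by (auto simp: factor_def)
  have u: "?u \<in> carrier ?UP" by (rule monic_linear_eq(1)[OF a])
  have ca: "?a \<in> carrier ?UP" using a by simp
  have X: "X \<in> carrier ?UP" by (rule var_closed(1)[OF carrier_is_subring])
  have cha: "[p] \<cdot>\<^bsub>?UP\<^esub> \<one>\<^bsub>?UP\<^esub> = \<zero>\<^bsub>?UP\<^esub>"
    using c.hom_add_pow[of \<one> p] char by simp
  have caN: "?a [^]\<^bsub>?UP\<^esub> ?N = ?a" using c.hom_nat_pow[OF a, of ?N] root by simp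
  have XN: "X [^]\<^bsub>?UP\<^esub> ?N = ?u [^]\<^bsub>?UP\<^esub> ?N \<oplus>\<^bsub>?UP\<^esub> ?a"
    using UP.freshmans_dream_power[OF p cha u ca, of n] caN
    by (simp add: monic_linear_eq(2)[OF a, symmetric])
  define v where "v = ?u [^]\<^bsub>?UP\<^esub> M"
  have v: "v \<in> carrier ?UP" using u by (simp add: v_def)
  have uN: "?u [^]\<^bsub>?UP\<^esub> ?N = ?u [^]\<^bsub>?UP\<^esub> (2::nat) \<otimes>\<^bsub>?UP\<^esub> v"
    using u unfolding M v_def by (simp add: UP.nat_pow_mult)
  define u2 where "u2 = ?u [^]\<^bsub>?UP\<^esub> (2::nat)"
  have u2c: "u2 \<in> carrier ?UP" using u by (simp add: u2_def)
  have "?u = ?u [^]\<^bsub>?UP\<^esub> ?N \<ominus>\<^bsub>?UP\<^esub> ?P"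
  proof -
    have PN: "?P = (?u [^]\<^bsub>?UP\<^esub> ?N \<oplus>\<^bsub>?UP\<^esub> ?a) \<ominus>\<^bsub>?UP\<^esub> (?u \<oplus>\<^bsub>?UP\<^esub> ?a)"
      using XN monic_linear_eq(2)[OF a] by simp
    have "?u [^]\<^bsub>?UP\<^esub> ?N \<in> carrier ?UP" using u by simp
    then show ?thesis unfolding PN using u ca by algebra
  qed
  also have "\<dots> = u2 \<otimes>\<^bsub>?UP\<^esub> v \<ominus>\<^bsub>?UP\<^esub> u2 \<otimes>\<^bsub>?UP\<^esub> w"
    using w(2) uN by (simp add: u2_def)
  also have "\<dots> = u2 \<otimes>\<^bsub>?UP\<^esub> (v \<ominus>\<^bsub>?UP\<^esub> w)"
    using u2c v w(1) by algebra
  finally have "u2 pdivides ?u"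
    using v w(1) by (auto simp: pdivides_def factor_def)
  then have "degree u2 \<le> degree ?u"
    using pdivides_imp_degree_le[OF carrier_is_subring u2c u] by simp
  moreover have "degree u2 = 2"
    using polynomial_pow_degree[OF u, of 2] by (simp add: u2_def)
  ultimately show False by simp
qed

lemma (in algebraically_closed) card_frobenius_fixed_eq:
  fixes p n :: nat
  assumes p: "Factorial_Ring.prime p" and char: "[p] \<cdot> \<one> = \<zero>" and n: "n > 0"
  shows "card {x \<in> carrier L. x [^] (p ^ n) = x} = p ^ n"
proof -
  let ?P = "X [^]\<^bsub>poly_ring L\<^esub> (p ^ n) \<ominus>\<^bsub>poly_ring L\<^esub> X"
  have N1: "p ^ n > 1"
    using one_less_power[OF prime_gt_1_nat[OF p] n] .
  note P = frobenius_poly[OF N1]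
  have mem: "a \<in># roots ?P \<longleftrightarrow> a \<in> carrier L \<and> a [^] (p ^ n) = a" for a
  proof -
    have "a \<in># roots ?P \<longleftrightarrow> a \<in> carrier L \<and> a [^] (p ^ n) \<ominus> a = \<zero>"
      using roots_mem_iff_is_root[OF P(1), of a] P(3) P(4)[of a] by (auto simp: is_root_def)
    then show ?thesis by (metis nat_pow_closed r_right_minus_eq)
  qed
  have "count (roots ?P) a = 1" if "a \<in># roots ?P" for a
  proof (rule antisym)
    show "count (roots ?P) a \<le> 1"
      using frobenius_poly_simple_roots[OF p char n, of a] that mem
        alg_mult_eq_count_roots[OF P(1)] by simp
    show "1 \<le> count (roots ?P) a" using that by (simp add: Suc_le_eq)
  qed
  then have "size (roots ?P) = card (set_mset (roots ?P))"
    by (simp add: size_multiset_overloaded_eq)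
  moreover have "size (roots ?P) = p ^ n"
    using roots_over_carrier[OF P(1)] P(2) by (simp add: splitted_def)
  moreover have "set_mset (roots ?P) = {x \<in> carrier L. x [^] (p ^ n) = x}"
    using mem by auto
  ultimately show ?thesis by simp
qed

text \<open>
  The field is the set of solutions of \<open>x\<^sup>N = x\<close>, for \<open>N = p\<^sup>n\<close>, in an algebraic closure of the
  prime field.  It is transported to the carrier \<open>{..<p ^ n}\<close> because the maximum
  \<^const>\<open>sudoku_sigma_max\<close> ranges over latin squares on an initial segment of the natural
  numbers; a field living there needs no further relabelling.
\<close>

lemma exists_field_of_prime_power_order:
  fixes p n :: nat
  assumes p: "Factorial_Ring.prime p" and n: "n > 0"
  shows "\<exists>F :: nat ring. field F \<and> carrier F = {..<p ^ n}"
proof -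
  interpret Zp: residues_prime p "residue_ring (int p)"
    using p by (simp add: residues_prime_def)
  interpret Zp: field "residue_ring (int p)" by (rule Zp.is_field)
  let ?Z = "residue_ring (int p)"
  obtain L :: "((int list \<times> nat) multiset \<Rightarrow> int) ring" where
    L: "algebraic_closure L (Zp.indexed_const ` carrier ?Z)"
    and hom: "Zp.indexed_const \<in> ring_hom ?Z L"
    using Zp.exists_closure by blast
  interpret L: algebraic_closure L "Zp.indexed_const ` carrier ?Z" by (rule L)
  interpret h: ring_hom_ring ?Z L Zp.indexed_const
    using hom by (intro ring_hom_ringI2) (auto intro: Zp.ring_axioms L.ring_axioms)
  have "card (carrier ?Z) = p ^ 1" by (simp add: Zp.res_carrier_eq)
  then have "[p] \<cdot>\<^bsub>?Z\<^esub> \<one>\<^bsub>?Z\<^esub> = \<zero>\<^bsub>?Z\<^esub>"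
    using Zp.characteristic_of_prime_power_order[of p 1] by simp
  then have char: "[p] \<cdot>\<^bsub>L\<^esub> \<one>\<^bsub>L\<^esub> = \<zero>\<^bsub>L\<^esub>"
    using h.hom_add_pow[of "\<one>\<^bsub>?Z\<^esub>" p] by simp
  define S where "S = {x \<in> carrier L. x [^]\<^bsub>L\<^esub> (p ^ n) = x}"
  have card: "card S = p ^ n"
    unfolding S_def by (rule L.card_frobenius_fixed_eq[OF p char n])
  moreover have "p ^ n > 0" using p by (simp add: prime_gt_0_nat)
  ultimately have "finite S" by (intro card_ge_0_finite) simp
  then obtain f where f: "bij_betw f S {..<p ^ n}"
    using card by (metis bij_betw_iff_card finite_lessThan card_lessThan)
  have "subfield S L"
    unfolding S_def by (rule L.frobenius_fixed_subfield[OF p char])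
  then interpret S: field "L\<lparr>carrier := S\<rparr>" by (rule L.subfield_iff(2))
  have "field (image_ring f (L\<lparr>carrier := S\<rparr>))"
    using f by (intro S.inj_imp_image_ring_is_field) (simp add: bij_betw_def)
  moreover have "carrier (image_ring f (L\<lparr>carrier := S\<rparr>)) = {..<p ^ n}"
    using f by (simp add: image_ring_carrier bij_betw_def)
  ultimately show ?thesis by blast
qed

section \<open>Planes over a subfield\<close>

lemma (in field) card_Span_independent:
  assumes k: "subfield k R" and fin: "finite k" and ind: "independent k Us"
  shows "card (Span k Us) = card k ^ length Us"
  using ind
proof (induction Us rule: list.induct)
  case Nil
  show ?case by simp
next
  case (Cons u Us)
  note u = independent_backwards[OF Cons.prems]
  have Us: "set Us \<subseteq> carrier R" using independent_in_carrier[OF u(2)] .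
  note kc = subsetD[OF subfieldE(3)[OF k]]
  note sub = Span_subgroup_props[OF k Us]
  let ?f = "\<lambda>(a, v). a \<otimes> u \<oplus> v"
  have "inj_on ?f (k \<times> Span k Us)"
  proof (rule inj_onI, clarify)
    fix a v b w
    assume m: "a \<in> k" "v \<in> Span k Us" "b \<in> k" "w \<in> Span k Us" and e: "a \<otimes> u \<oplus> v = b \<otimes> u \<oplus> w"
    have c: "a \<in> carrier R" "b \<in> carrier R" "v \<in> carrier R" "w \<in> carrier R"
      using m kc sub(1) by auto
    have "(a \<ominus> b) \<otimes> u = (a \<otimes> u \<oplus> v) \<ominus> v \<ominus> b \<otimes> u" using c u(3) by algebra
    also have "\<dots> = (b \<otimes> u \<oplus> w) \<ominus> v \<ominus> b \<otimes> u" by (simp only: e)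
    also have "\<dots> = w \<oplus> \<ominus> v" using c u(3) by algebra
    also have "\<dots> \<in> Span k Us" using sub m by blast
    finally have "(a \<ominus> b) \<otimes> u \<in> Span k Us" .
    moreover have "a \<ominus> b \<in> k"
      using subringE(5,7)[OF subfieldE(1)[OF k]] m by (simp add: a_minus_def)
    ultimately have "a \<ominus> b = \<zero>"
      using Span_m_inv_simprule[OF k Us, of "a \<ominus> b" u] u by blast
    then have "a = b" using c by simp
    moreover have "v = w" using e c u(3) unfolding \<open>a = b\<close> by simp
    ultimately show "a = b \<and> v = w" ..
  qed
  moreover have "Span k (u # Us) = ?f ` (k \<times> Span k Us)"
    by (auto simp: line_extension_mem_iff image_iff) blast
  ultimately show ?case
    using Cons.IH[OF u(2)] by (simp add: card_image card_cartesian_product del: Span.simps)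
qed

lemma (in field) independent_pair_iff:
  assumes "subfield k R"
  shows "independent k [u, v] \<longleftrightarrow> v \<in> carrier R - {\<zero>} \<and> u \<in> carrier R - Span k [v]"
proof
  assume i: "independent k [u, v]"
  note i1 = independent_backwards[OF i] and i2 = independent_backwards[OF independent_backwards(2)[OF i]]
  show "v \<in> carrier R - {\<zero>} \<and> u \<in> carrier R - Span k [v]"
    using i1(1,3) i2(1,3) by simp
next
  assume "v \<in> carrier R - {\<zero>} \<and> u \<in> carrier R - Span k [v]"
  then show "independent k [u, v]"
    by (intro li_Cons li_Nil) auto
qed

text \<open>
  The ordered bases of the planes contained in a subspace \<open>V\<close>; the second component of a pair is
  the head of the spanned list, because independence of a list is tested on its tail first.
\<close>

definition (in ring) plane_bases :: "'a set \<Rightarrow> 'a set \<Rightarrow> ('a \<times> 'a) set" where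
  "plane_bases k V = (SIGMA v:V - {\<zero>}. V - Span k [v])"

lemma (in field) card_plane_bases:
  assumes k: "subfield k R" and V: "finite V" "V \<subseteq> carrier R" "\<zero> \<in> V"
    and lines: "\<And>v. v \<in> V \<Longrightarrow> Span k [v] \<subseteq> V"
  shows "card (plane_bases k V) = (card V - 1) * (card V - card k)"
proof -
  have "card (V - Span k [v]) = card V - card k" if v: "v \<in> V - {\<zero>}" for v
  proof -
    have sub: "Span k [v] \<subseteq> V" using lines v by blast
    have fS: "finite (Span k [v])" using sub V(1) finite_subset by blast
    have ind: "independent k [v]" using v V by (intro li_Cons li_Nil) auto
    have fk: "finite k"
    proof (rule inj_on_finite[OF _ _ V(1)])
      show "inj_on (\<lambda>a. a \<otimes> v) k"
      proof (rule inj_onI)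
        fix a b assume "a \<in> k" "b \<in> k" "a \<otimes> v = b \<otimes> v"
        then show "a = b" using m_rcancel[of v a b] v V(2) subfieldE(3)[OF k] by auto
      qed
      show "(\<lambda>a. a \<otimes> v) ` k \<subseteq> V"
        using Span_smult_closed[OF k, of "[v]"] Span_base_incl[OF k, of "[v]"] sub v V(2)
        by (auto simp del: Span.simps)
    qed
    show ?thesis
      using card_Span_independent[OF k fk ind] card_Diff_subset[OF fS sub] by simp
  qed
  then have "card (plane_bases k V) = (\<Sum>v\<in>V - {\<zero>}. card V - card k)"
    unfolding plane_bases_def using V(1) by (subst card_SigmaI) auto
  then show ?thesis using V by simp
qed

text \<open>
  Each plane has at most \<open>(r\<^sup>2 - 1)(r\<^sup>2 - r)\<close> ordered bases, since they all lie in the plane itself,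
  while the whole field, of dimension 4, has \<open>(r\<^sup>4 - 1)(r\<^sup>4 - r)\<close> ordered independent pairs.
\<close>

lemma (in field) card_planes_ge:
  assumes k: "subfield k R" and fin: "finite (carrier R)"
    and r: "card k = r" and card: "card (carrier R) = r ^ 4"
  shows "(r ^ 4 - 1) * (r ^ 4 - r) \<le>
    (r\<^sup>2 - 1) * (r\<^sup>2 - r) * card ((\<lambda>(v, u). Span k [u, v]) ` plane_bases k (carrier R))"
proof -
  let ?f = "\<lambda>(v, u). Span k [u, v]" and ?D = "plane_bases k (carrier R)"
  have fk: "finite k" using finite_subset[OF subfieldE(3)[OF k] fin] .
  have finD: "finite ?D" using fin by (auto simp: plane_bases_def)
  have cD: "card ?D = (r ^ 4 - 1) * (r ^ 4 - r)"
  proof (subst card_plane_bases[OF k fin])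
    show "Span k [v] \<subseteq> carrier R" if "v \<in> carrier R" for v
      using Span_subgroup_props(1)[OF k, of "[v]"] that by simp
  qed (simp_all add: r card)
  have fib: "card {x \<in> ?D. ?f x = H} \<le> (r\<^sup>2 - 1) * (r\<^sup>2 - r)" if H: "H \<in> ?f ` ?D" for H
  proof -
    from H obtain u v where uv: "(v, u) \<in> ?D" "H = Span k [u, v]"
      by (elim imageE) (auto simp del: Span.simps)
    then have ind: "independent k [u, v]"
      unfolding independent_pair_iff[OF k] by (simp add: plane_bases_def del: Span.simps)
    have cuv: "set [u, v] \<subseteq> carrier R" by (rule independent_in_carrier[OF ind])
    have cH: "card H = r\<^sup>2"
      using card_Span_independent[OF k fk ind] uv r by (simp add: power2_eq_square)
    note props = Span_subgroup_props[OF k cuv, folded uv(2)]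
    have fH: "finite H" using props(1) fin finite_subset by blast
    have "card {x \<in> ?D. ?f x = H} \<le> card (plane_bases k H)"
    proof (rule card_mono)
      show "finite (plane_bases k H)" using fH by (auto simp: plane_bases_def)
      show "{x \<in> ?D. ?f x = H} \<subseteq> plane_bases k H"
      proof clarify
        fix a b assume ab: "(a, b) \<in> ?D" "H = Span k [b, a]"
        then have "set [b, a] \<subseteq> carrier R" by (auto simp: plane_bases_def)
        then have "a \<in> H" "b \<in> H" using Span_base_incl[OF k, of "[b, a]"] ab(2) by (auto simp del: Span.simps)
        then show "(a, b) \<in> plane_bases k (Span k [b, a])"
          using ab by (simp add: plane_bases_def del: Span.simps)
      qed
    qed
    also have "card (plane_bases k H) = (card H - 1) * (card H - card k)"
    proof (rule card_plane_bases[OF k fH props(1,2)])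
      show "Span k [w] \<subseteq> H" if "w \<in> H" for w
        unfolding uv(2) using that uv(2) by (intro mono_Span_subset[OF k _ cuv]) simp
    qed
    finally show ?thesis unfolding cH r .
  qed
  show ?thesis using card_le_mult_card_image_fibres[OF finD fib] unfolding cD .
qed

text \<open>
  If \<open>cw\<close> were on the line through \<open>w\<close>, then cancelling \<open>w\<close> would put \<open>c\<close> into \<open>k\<close>.
\<close>

lemma (in field) independent_mult:
  assumes k: "subfield k R" and c: "c \<in> carrier R - k" and w: "w \<in> carrier R - {\<zero>}"
  shows "independent k [c \<otimes> w, w]"
  unfolding independent_pair_iff[OF k]
proof (intro conjI w)
  have "c \<otimes> w \<notin> Span k [w]"
  proof
    assume "c \<otimes> w \<in> Span k [w]"
    then obtain a where a: "a \<in> k" "c \<otimes> w = a \<otimes> w"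
      using w subfieldE(3)[OF k] by (auto simp: line_extension_mem_iff)
    then have "c = a" using m_rcancel[of w c a] c w subfieldE(3)[OF k] by auto
    then show False using a c by simp
  qed
  then show "c \<otimes> w \<in> carrier R - Span k [w]" using c w by simp
qed

text \<open>
  The plane spanned by \<open>cw\<close> and \<open>w\<close> depends only on \<open>w\<close> up to a nonzero factor in \<open>k\<close>, so it arises from at
  least \<open>r - 1\<close> elements \<open>w\<close>.
\<close>

lemma (in field) card_multiples_planes_le:
  assumes k: "subfield k R" and fin: "finite (carrier R)" and r: "card k = r"
    and c: "c \<in> carrier R - k"
  shows "(r - 1) * card ((\<lambda>w. Span k [c \<otimes> w, w]) ` (carrier R - {\<zero>})) \<le> card (carrier R) - 1"
proof -
  let ?W = "carrier R - {\<zero>}" and ?g = "\<lambda>w. Span k [c \<otimes> w, w]"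
  have fk: "finite k" using finite_subset[OF subfieldE(3)[OF k] fin] .
  note kc = subsetD[OF subfieldE(3)[OF k]]
  have "(r - 1) * card (?g ` ?W) \<le> card ?W"
  proof (rule mult_card_image_fibres_le_card)
    fix H assume "H \<in> ?g ` ?W"
    then obtain w where w: "w \<in> ?W" "H = ?g w" by (elim imageE)
    have "r - 1 = card (k - {\<zero>})"
      using subringE(2)[OF subfieldE(1)[OF k]] r fk by simp
    also have "\<dots> = card ((\<lambda>a. a \<otimes> w) ` (k - {\<zero>}))"
    proof (rule card_image [symmetric], rule inj_onI)
      fix a b assume "a \<in> k - {\<zero>}" "b \<in> k - {\<zero>}" "a \<otimes> w = b \<otimes> w"
      then show "a = b" using m_rcancel[of w a b] w kc by auto
    qed
    also have "\<dots> \<le> card {x \<in> ?W. ?g x = H}"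
    proof (rule card_mono)
      show "(\<lambda>a. a \<otimes> w) ` (k - {\<zero>}) \<subseteq> {x \<in> ?W. ?g x = H}"
      proof (rule image_subsetI)
        fix a assume a: "a \<in> k - {\<zero>}"
        then have ac: "a \<in> carrier R" using kc by blast
        have aw: "a \<otimes> w \<in> ?W" using a ac w by (simp add: integral_iff)
        have cw: "set [c \<otimes> w, w] \<subseteq> carrier R" using c w by simp
        have base: "w \<in> ?g w" "c \<otimes> w \<in> ?g w" using Span_base_incl[OF k cw] by (auto simp del: Span.simps)
        have ca: "c \<otimes> (a \<otimes> w) = a \<otimes> (c \<otimes> w)" using c ac w by (simp add: m_lcomm)
        have "?g (a \<otimes> w) \<subseteq> ?g w"
          unfolding ca
          using a base Span_smult_closed[OF k cw] by (intro mono_Span_subset[OF k _ cw]) (simp del: Span.simps)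
        moreover have "finite (?g w)"
          using Span_subgroup_props(1)[OF k cw] fin finite_subset by blast
        moreover have "card (?g (a \<otimes> w)) = card (?g w)"
          using card_Span_independent[OF k fk independent_mult[OF k c aw]]
            card_Span_independent[OF k fk independent_mult[OF k c w(1)]] by (simp del: Span.simps)
        ultimately have "?g (a \<otimes> w) = ?g w" by (intro card_subset_eq)
        then show "a \<otimes> w \<in> {x \<in> ?W. ?g x = H}" using aw w(2) by (simp del: Span.simps)
      qed
    qed (use fin in simp)
    finally show "r - 1 \<le> card {x \<in> ?W. ?g x = H}" .
  qed (use fin in simp)
  then show ?thesis using fin by simp
qed

text \<open>
  The numbers behind the two hypotheses are \<open>(r\<^sup>2 + 1)(r\<^sup>2 + r + 1) \<le> a\<close> and
  \<open>b \<le> (r\<^sup>2 + 1)(r + 1)\<close>, whose difference is \<open>(r\<^sup>2 + 1)r\<^sup>2\<close>.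
\<close>

lemma plane_count_arith:
  fixes r a b :: nat
  assumes r: "r \<ge> 2"
    and a: "(r ^ 4 - 1) * (r ^ 4 - r) \<le> (r\<^sup>2 - 1) * (r\<^sup>2 - r) * a"
    and b: "(r - 1) * b \<le> r ^ 4 - 1"
  shows "(r\<^sup>2)\<^sup>2 + r\<^sup>2 \<le> a - b"
proof -
  obtain t where t: "r = Suc t" "t > 0" using r by (cases r) auto
  have r4: "r ^ 4 - 1 = (r\<^sup>2 - 1) * (r\<^sup>2 + 1)" "r ^ 4 - 1 = (r - 1) * ((r + 1) * (r\<^sup>2 + 1))"
    "r ^ 4 - r = (r\<^sup>2 - r) * (r\<^sup>2 + r + 1)"
    unfolding t(1) by (simp_all add: algebra_simps eval_nat_numeral)
  have pos: "(r\<^sup>2 - 1) * (r\<^sup>2 - r) > 0" "r - 1 > 0"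
    using t by (simp_all add: power2_eq_square)
  have "(r\<^sup>2 - 1) * (r\<^sup>2 - r) * ((r\<^sup>2 + 1) * (r\<^sup>2 + r + 1)) \<le> (r\<^sup>2 - 1) * (r\<^sup>2 - r) * a"
    using a unfolding r4(1) r4(3) by (simp only: ac_simps)
  then have a': "(r\<^sup>2 + 1) * (r\<^sup>2 + r + 1) \<le> a" using pos(1) by (simp only: mult_le_cancel1)
  have "(r - 1) * b \<le> (r - 1) * ((r + 1) * (r\<^sup>2 + 1))" using b unfolding r4(2) .
  then have b': "b \<le> (r + 1) * (r\<^sup>2 + 1)" using pos(2) by (simp only: mult_le_cancel1)
  have "(r\<^sup>2)\<^sup>2 + r\<^sup>2 + (r + 1) * (r\<^sup>2 + 1) = (r\<^sup>2 + 1) * (r\<^sup>2 + r + 1)"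
    by (simp add: algebra_simps eval_nat_numeral)
  then show ?thesis using a' b' by linarith
qed

text \<open>
  A plane \<open>H\<close> over \<open>k\<close> that contains \<open>h \<noteq> \<zero>\<close> together with \<open>ch\<close> is the plane spanned by \<open>ch\<close> and
  \<open>h\<close>.  Hence every plane that is not of this special form meets the requirement of
  \<open>division_sudoku_cosets\<close>.
\<close>

lemma (in field) many_free_subgroups:
  assumes k: "subfield k R" and fin: "finite (carrier R)"
    and r: "card k = r" and card: "card (carrier R) = r ^ 4" and c: "c \<in> carrier R - k"
  shows "(r\<^sup>2)\<^sup>2 + r\<^sup>2 \<le> card {H. additive_subgroup H R \<and> card H = r\<^sup>2 \<and>
                              (\<forall>h\<in>H. c \<otimes> h \<in> H \<longrightarrow> h = \<zero>)}"
proof -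
  let ?P = "(\<lambda>(v, u). Span k [u, v]) ` plane_bases k (carrier R)"
  let ?B = "(\<lambda>w. Span k [c \<otimes> w, w]) ` (carrier R - {\<zero>})"
  let ?G = "{H. additive_subgroup H R \<and> card H = r\<^sup>2 \<and> (\<forall>h\<in>H. c \<otimes> h \<in> H \<longrightarrow> h = \<zero>)}"
  have fk: "finite k" using finite_subset[OF subfieldE(3)[OF k] fin] .
  have oz: "\<one> \<in> k" "\<zero> \<in> k" "\<one> \<noteq> \<zero>"
    using subringE(2,3)[OF subfieldE(1)[OF k]] by auto
  then have r2: "r \<ge> 2" using card_mono[OF fk, of "{\<zero>, \<one>}"] r by simp
  have "(r\<^sup>2)\<^sup>2 + r\<^sup>2 \<le> card ?P - card ?B"
    using plane_count_arith[OF r2 card_planes_ge[OF k fin r card]]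
      card_multiples_planes_le[OF k fin r c] card by (simp del: Span.simps)
  also have "\<dots> \<le> card (?P - ?B)"
    using fin by (intro diff_card_le_card_Diff) simp
  also have "\<dots> \<le> card ?G"
  proof (rule card_mono)
    have "?G \<subseteq> Pow (carrier R)" by (auto dest: additive_subgroup.a_Hcarr)
    then show "finite ?G" using fin finite_subset by blast
    show "?P - ?B \<subseteq> ?G"
    proof
      fix H assume H: "H \<in> ?P - ?B"
      then obtain u v where uv: "(v, u) \<in> plane_bases k (carrier R)" "H = Span k [u, v]"
        by (auto simp del: Span.simps)
      then have ind: "independent k [u, v]"
        unfolding independent_pair_iff[OF k] by (simp add: plane_bases_def del: Span.simps)
      have cuv: "set [u, v] \<subseteq> carrier R" by (rule independent_in_carrier[OF ind])
      have cH: "card H = r\<^sup>2"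
        using card_Span_independent[OF k fk ind] uv r by (simp add: power2_eq_square)
      have add: "additive_subgroup H R"
        unfolding uv(2) using Span_is_add_subgroup[OF k cuv] by (rule additive_subgroupI)
      have HR: "H \<subseteq> carrier R" unfolding uv(2) by (rule Span_subgroup_props(1)[OF k cuv])
      have "h = \<zero>" if h: "h \<in> H" "c \<otimes> h \<in> H" for h
      proof (rule ccontr)
        assume "h \<noteq> \<zero>"
        then have hW: "h \<in> carrier R - {\<zero>}" using h HR by auto
        have "Span k [c \<otimes> h, h] \<subseteq> H"
          unfolding uv(2) using h unfolding uv(2)
          by (intro mono_Span_subset[OF k _ cuv]) (simp del: Span.simps)
        moreover have "card (Span k [c \<otimes> h, h]) = card H"
          using card_Span_independent[OF k fk independent_mult[OF k c hW]] cH r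
          by (simp add: power2_eq_square)
        ultimately have "Span k [c \<otimes> h, h] = H"
          using HR fin finite_subset by (intro card_subset_eq) blast+
        then have "H \<in> ?B" using hW by (intro image_eqI[of H _ h]) (simp_all del: Span.simps)
        then show False by (rule DiffD2[OF H])
      qed
      then show "H \<in> ?G" using add cH by blast
    qed
  qed
  finally show ?thesis .
qed

section \<open>The number of sudoku partitions\<close>

text \<open>
  A subgroup is the block of \<open>\<zero>\<close> in its coset partition, so different subgroups give different
  sudoku partitions.
\<close>

lemma (in abelian_group) a_rcosets_inj:
  assumes fin: "finite (carrier G)" and H: "additive_subgroup H G" and K: "additive_subgroup K G"
    and eq: "a_rcosets H = a_rcosets K"
  shows "H = K"
proof -
  have "H \<in> a_rcosets H" "K \<in> a_rcosets H"
    using a_rcosets_partition(4)[OF H fin] a_rcosets_partition(4)[OF K fin] eq by auto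
  moreover have "\<zero> \<in> H" "\<zero> \<in> K" using H K by (auto intro: additive_subgroup.zero_closed)
  ultimately show ?thesis
    using a_rcosets_partition(1)[OF H fin] by (auto simp: partition_on_def disjoint_def)
qed

lemma finite_sudoku_partitions:
  assumes "finite V"
  shows "finite {P. \<exists>m. division_sudoku_wrt m V P L}"
proof (rule finite_subset)
  show "{P. \<exists>m. division_sudoku_wrt m V P L} \<subseteq> Pow (Pow V)"
    by (auto simp: division_sudoku_wrt_def sudoku_partition_def partition_on_def)
qed (use assms in simp)

lemma (in field) DS_sigma_ge:
  assumes k: "subfield k R" and fin: "finite (carrier R)"
    and r: "card k = r" and card: "card (carrier R) = r ^ 4" and c: "c \<in> carrier R - k"
  shows "division_sudoku (r\<^sup>2) (carrier R) (DS R c)"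
    and "(r\<^sup>2)\<^sup>2 + r\<^sup>2 \<le> sudoku_sigma (carrier R) (DS R c)"
proof -
  let ?G = "{H. additive_subgroup H R \<and> card H = r\<^sup>2 \<and> (\<forall>h\<in>H. c \<otimes> h \<in> H \<longrightarrow> h = \<zero>)}"
  have c': "c \<in> carrier R" "c \<noteq> \<zero>" "c \<noteq> \<one>"
    using c subringE(2,3)[OF subfieldE(1)[OF k]] by auto
  have ds: "division_sudoku_wrt (r\<^sup>2) (carrier R) (a_rcosets H) (DS R c)" if "H \<in> ?G" for H
    using that card by (intro division_sudoku_cosets fin c') (auto simp: power_mult [symmetric])
  have many: "(r\<^sup>2)\<^sup>2 + r\<^sup>2 \<le> card ?G" by (rule many_free_subgroups[OF k fin r card c])
  have "carrier R \<noteq> {}" using one_closed by blast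
  then have "r \<noteq> 0" using card fin by (cases "r = 0") simp_all
  then have "(r\<^sup>2)\<^sup>2 + r\<^sup>2 > 0" by simp
  then have "card ?G \<noteq> 0" using many by linarith
  then have "?G \<noteq> {}" by (metis card.empty)
  then show "division_sudoku (r\<^sup>2) (carrier R) (DS R c)"
    using ds unfolding division_sudoku_def by blast
  have "inj_on (\<lambda>H. a_rcosets H) ?G"
    by (rule inj_onI) (use a_rcosets_inj[OF fin] in blast)
  then have "card ?G = card ((\<lambda>H. a_rcosets H) ` ?G)" by (simp add: card_image)
  also have "\<dots> \<le> sudoku_sigma (carrier R) (DS R c)"
    unfolding sudoku_sigma_def using ds
    by (intro card_mono finite_sudoku_partitions fin) blast
  finally show "(r\<^sup>2)\<^sup>2 + r\<^sup>2 \<le> sudoku_sigma (carrier R) (DS R c)" using many by simp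
qed

text \<open>
  A maximum over a set bounds its members only if the set is finite; here no value exceeds the
  number of all families of subsets of \<open>{..<m\<^sup>2}\<close>.
\<close>

lemma sudoku_sigma_le_max:
  assumes "division_sudoku m {..<m\<^sup>2} L"
  shows "sudoku_sigma {..<m\<^sup>2} L \<le> sudoku_sigma_max m"
  unfolding sudoku_sigma_max_def
proof (rule Max_ge)
  have "sudoku_sigma {..<m\<^sup>2} L' \<le> card (Pow (Pow {..<m\<^sup>2}))" for L' :: "nat \<Rightarrow> nat \<Rightarrow> nat"
    unfolding sudoku_sigma_def
    by (rule card_mono)
      (auto simp: division_sudoku_wrt_def sudoku_partition_def partition_on_def)
  then show "finite {sudoku_sigma {..<m\<^sup>2} L |L. division_sudoku m {..<m\<^sup>2} L}"
    by (intro finite_subset[OF _ finite_atMost[of "card (Pow (Pow {..<m\<^sup>2}))"]]) auto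
qed (use assms in blast)

theorem theorem6p6:
  fixes p s q :: nat
  assumes "Factorial_Ring.prime p" and "s \<ge> 1" and "q = p ^ (2 * s)"
  shows "(\<forall>(F :: ('a, 'b) ring_scheme) K c.
            field F \<and> order F = q\<^sup>2 \<and> subfield K F \<and> card K = q \<and> c \<in> carrier F - K \<longrightarrow>
              division_sudoku q (carrier F) (DS F c) \<and>
              sudoku_sigma (carrier F) (DS F c) \<ge> q\<^sup>2 + q) \<and>
         q\<^sup>2 + q = p ^ (4 * s) + p ^ (2 * s) \<and>
         sudoku_sigma_max (p ^ (2 * s)) \<ge> p ^ (4 * s) + p ^ (2 * s)"
proof -
  define r where "r = p ^ s"
  have q: "q = r\<^sup>2" using assms(3) by (simp add: r_def power_mult [symmetric] mult.commute)
  have q4: "q\<^sup>2 = r ^ 4" "q\<^sup>2 = p ^ (s * 4)" "q\<^sup>2 = p ^ (4 * s)"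
    using q by (simp_all add: r_def power_mult [symmetric] mult.commute)
  have r2: "r \<ge> 2"
    using assms(2) prime_ge_2_nat[OF assms(1)] self_le_power[of p s] unfolding r_def by linarith
  have small: "\<exists>k. subfield k F \<and> card k = r \<and> k = {x \<in> carrier F. x [^]\<^bsub>F\<^esub> r = x}"
    if F: "field F" "finite (carrier F)" "card (carrier F) = q\<^sup>2" for F :: "('c, 'd) ring_scheme"
  proof -
    interpret field F by (rule F)
    have "[p] \<cdot>\<^bsub>F\<^esub> \<one>\<^bsub>F\<^esub> = \<zero>\<^bsub>F\<^esub>"
      using F(2,3) q4(2) by (intro characteristic_of_prime_power_order) simp_all
    then have "subfield {x \<in> carrier F. x [^]\<^bsub>F\<^esub> r = x} F"
      unfolding r_def by (rule frobenius_fixed_subfield[OF assms(1)])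
    moreover have "card {x \<in> carrier F. x [^]\<^bsub>F\<^esub> r = x} = r"
      using card_frobenius_fixed[OF F(2) _ r2, of 4] F(3) q4(1) by simp
    ultimately show ?thesis by blast
  qed
  have main: "division_sudoku q (carrier F) (DS F c) \<and> sudoku_sigma (carrier F) (DS F c) \<ge> q\<^sup>2 + q"
    if F: "field F" "order F = q\<^sup>2" and K: "subfield K F" "card K = q" and c: "c \<in> carrier F - K"
    for F :: "('a, 'b) ring_scheme" and K c
  proof -
    interpret field F by (rule F)
    have cF: "card (carrier F) = q\<^sup>2" using F(2) by (simp add: order_def)
    have q0: "q > 0" using q r2 by simp
    have fin: "finite (carrier F)" using cF q0 by (metis card_ge_0_finite zero_less_power)
    obtain k where k: "subfield k F" "card k = r" "k = {x \<in> carrier F. x [^]\<^bsub>F\<^esub> r = x}"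
      using small[OF F(1) fin cF] by blast
    \<comment> \<open>Both are fields of Frobenius-fixed elements, and \<open>x\<^sup>r = x\<close> implies \<open>x\<^sup>q = x\<close> for \<open>q = r\<^sup>2\<close>.\<close>
    have "k \<subseteq> K"
    proof
      fix x assume "x \<in> k"
      then have x: "x \<in> carrier F" "x [^]\<^bsub>F\<^esub> r = x" using k(3) by auto
      have "x [^]\<^bsub>F\<^esub> q = (x [^]\<^bsub>F\<^esub> r) [^]\<^bsub>F\<^esub> r"
        using x(1) by (simp add: q nat_pow_pow power2_eq_square)
      then have "x [^]\<^bsub>F\<^esub> q = x" using x(2) by simp
      then show "x \<in> K"
        using subfield_eq_frobenius_fixed[OF fin K(1), of 2] cF K(2) x(1) by auto
    qed
    then have "c \<in> carrier F - k" using c by blast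
    then show ?thesis
      using DS_sigma_ge[OF k(1) fin k(2) _ \<open>c \<in> carrier F - k\<close>] cF q4(1) unfolding q by simp
  qed
  have "q\<^sup>2 + q \<le> sudoku_sigma_max q"
  proof -
    have "s * 4 > 0" using assms(2) by simp
    then obtain F :: "nat ring" where F: "field F" "carrier F = {..<q\<^sup>2}"
      using exists_field_of_prime_power_order[OF assms(1)] unfolding q4(2) by blast
    interpret field F by (rule F)
    have fin: "finite (carrier F)" and cF: "card (carrier F) = q\<^sup>2" using F(2) by simp_all
    obtain k where k: "subfield k F" "card k = r"
      using small[OF F(1) fin cF] by blast
    have "r ^ 1 < r ^ 4" using r2 by (intro power_strict_increasing) auto
    then have "carrier F \<noteq> k" using k(2) cF q4(1) by auto
    then obtain c where c: "c \<in> carrier F - k" using subfieldE(3)[OF k(1)] by blast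
    note ds = DS_sigma_ge[OF k(1) fin k(2) _ c, unfolded cF q4(1), OF refl, folded q, unfolded F(2)]
    show ?thesis using ds(2) sudoku_sigma_le_max[OF ds(1)] by simp
  qed
  then have max: "sudoku_sigma_max (p ^ (2 * s)) \<ge> p ^ (4 * s) + p ^ (2 * s)"
    using assms(3) q4(3) by simp
  show ?thesis
  proof (intro conjI allI impI)
    show "q\<^sup>2 + q = p ^ (4 * s) + p ^ (2 * s)" using assms(3) q4(3) by simp
  qed (use main max in blast)+
qed

end
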